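(* Let $a\neq 0$ be a positive integer such that there exists a $D(a)$-pair of triangular numbers. Then $a\not\equiv 2,5 \pmod 9$.
   Context: For a positive integer $n$, $T_n=\frac{n(n+1)}{2}$ denotes the $n$-th triangular number. For a non-zero integer $a$, a $D(a)$-pair is a set of two distinct positive integers whose product increased by $a$ is a perfect square. A $D(a)$-pair of triangular numbers is a $D(a)$-pair of the form $\{T_n,T_m\}$ with $n,m$ positive integers. *)

theory Defs
  imports
    "HOL-Library.Nat_Bijection"
    "HOL-Computational_Algebra.Nth_Powers"
    "HOL-Number_Theory.Cong"
begin

(* The property D(a); it is meant for non-zero a, which is assumed where the
   notion is used. Nat_Bijection.triangle n is the triangular number n(n+1)/2. *)
definition D_pair :: "int \<Rightarrow> nat set \<Rightarrow> bool" where
  "D_pair a S \<longleftrightarrow>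
     (\<exists>x y. S = {x, y} \<and> x \<noteq> y \<and> x > 0 \<and> y > 0 \<and> is_square (int x * int y + a))"

definition triangular_D_pair :: "int \<Rightarrow> nat set \<Rightarrow> bool" where
  "triangular_D_pair a S \<longleftrightarrow>
     D_pair a S \<and> (\<exists>n m. n > 0 \<and> m > 0 \<and> S = {triangle n, triangle m})"

end

theory Submission
  imports Defs
begin

text \<open>
  A triangular number is either divisible by 3 or congruent to 1 modulo 9, and this property is
  inherited by products. So if \<open>x y + a\<close> is a square, with \<open>x\<close>, \<open>y\<close> triangular and
  \<open>a \<equiv> 2\<close> modulo 3, there are two possibilities. Either \<open>x y\<close> is a multiple of 3, and the
  square would be 2 modulo 3, a non-residue; or \<open>x y \<equiv> 1\<close> modulo 9, and the square is a multiple
  of 3, hence of 9, so that \<open>a \<equiv> 8\<close> modulo 9. The residues 2 and 5, which are the other two lifts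
  of 2 to modulus 9, are therefore excluded.
\<close>

text \<open>
  The self-similarity behind the residue 1 modulo 9: \<open>8 T + 1\<close> is the square of \<open>2 n + 1\<close> for
  \<open>T = triangle n\<close>, and multiplying this square by 9 replaces \<open>T\<close> by \<open>9 T + 1\<close> and \<open>n\<close> by
  \<open>3 n + 1\<close>.
\<close>

lemma triangle_3_mult_plus_1: "triangle (3 * k + 1) = 9 * triangle k + 1"
proof (induction k)
  case (Suc k)
  have "3 * Suc k + 1 = Suc (Suc (Suc (3 * k + 1)))"
    by simp
  then show ?case
    using Suc.IH by (simp only: triangle_Suc) simp
qed simp

lemma triangle_cases_mod_9: "3 dvd triangle n \<or> [triangle n = 1] (mod 9)"
proof (cases "n mod 3 = 1")
  case True
  then have "n = 3 * (n div 3) + 1"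
    by presburger
  then have "triangle n = 9 * triangle (n div 3) + 1"
    using triangle_3_mult_plus_1 by metis
  then show ?thesis
    by (simp add: cong_def)
next
  case False
  then have "3 dvd n \<or> 3 dvd Suc n"
    by presburger
  then have "3 dvd n * Suc n"
    by (blast intro: dvd_mult dvd_mult2)
  also have "n * Suc n = 2 * triangle n"
    using Nat_Bijection.triangle_def by simp
  finally have "3 dvd triangle n"
    by presburger
  then show ?thesis ..
qed

text \<open>
  Being a multiple of 3 is absorbing and being 1 modulo 9 is multiplicative, so no case analysis
  over pairs of residues modulo 9 is needed.
\<close>

lemma triangle_mult_cases_mod_9:
  "3 dvd triangle m * triangle n \<or> [triangle m * triangle n = 1] (mod 9)"
  using triangle_cases_mod_9[of m] triangle_cases_mod_9[of n]
    cong_mult[of "triangle m" 1 9 "triangle n" 1] by auto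

lemma square_mod_3_neq_2:
  fixes z :: int
  shows "z\<^sup>2 mod 3 \<noteq> 2"
proof -
  have "z mod 3 \<in> {0, 1, 2}"
    by (simp, presburger)
  then have "(z mod 3)\<^sup>2 mod 3 \<noteq> 2"
    by auto
  then show ?thesis
    by (simp add: power_mod)
qed

lemma nine_dvd_square:
  fixes z :: int
  assumes "3 dvd z\<^sup>2"
  shows "9 dvd z\<^sup>2"
proof -
  have "prime (3 :: int)"
    by simp
  then have "3 dvd z"
    using assms prime_dvd_power by blast
  then have "3\<^sup>2 dvd z\<^sup>2"
    by (rule dvd_power_same)
  then show ?thesis
    by simp
qed

text \<open>
  This treats both excluded residues at once: among the \<open>a \<equiv> 2\<close> modulo 3, only \<open>a \<equiv> 8\<close> modulo 9
  can occur, and for \<open>a = 8\<close> it does, with \<open>m = n = 1\<close>.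
\<close>

lemma triangle_mult_plus_square_mod_9:
  fixes a :: int
  assumes "is_square (int (triangle m) * int (triangle n) + a)" and "a mod 3 = 2"
  shows "a mod 9 = 8"
proof -
  obtain z where z: "int (triangle m * triangle n) + a = z\<^sup>2"
    using assms(1) by (auto simp: is_nth_power_def)
  from triangle_mult_cases_mod_9[of m n] show ?thesis
  proof
    assume "3 dvd triangle m * triangle n"
    then have "z\<^sup>2 mod 3 = 2"
      using z assms(2) by presburger
    then show ?thesis
      using square_mod_3_neq_2 by blast
  next
    assume "[triangle m * triangle n = 1] (mod 9)"
    then have "[int (triangle m * triangle n) = 1] (mod 9)"
      using cong_int_iff[of "triangle m * triangle n" 1 9] by simp
    then have cong: "[z\<^sup>2 = 1 + a] (mod 9)"
      unfolding z[symmetric] by (simp add: cong_add_rcancel)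
    then have "[z\<^sup>2 = 1 + a] (mod 3)"
      by (rule cong_dvd_modulus) simp
    moreover have "3 dvd 1 + a"
      using assms(2) by presburger
    ultimately have "3 dvd z\<^sup>2"
      using cong_dvd_iff by blast
    then have "9 dvd z\<^sup>2"
      by (rule nine_dvd_square)
    then have "9 dvd 1 + a"
      using cong cong_dvd_iff by blast
    then show ?thesis
      by presburger
  qed
qed

theorem theorem6:
  fixes a :: int
  assumes "a \<noteq> 0" and "a > 0"
    and "\<exists>S. triangular_D_pair a S"
  shows "\<not> [a = 2] (mod 9) \<and> \<not> [a = 5] (mod 9)"
proof -
  obtain x y n m where xy: "is_square (int x * int y + a)"
    and eq: "{x, y} = {triangle n, triangle m}"
    using assms(3) unfolding triangular_D_pair_def D_pair_def by metis
  \<comment> \<open>The set does not remember the order of its elements, but the product does not depend on it.\<close>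
  have "int x * int y = int (triangle n) * int (triangle m)"
    using eq by (auto simp: doubleton_eq_iff)
  then have "is_square (int (triangle n) * int (triangle m) + a)"
    using xy(1) by simp
  then have "a mod 3 = 2 \<Longrightarrow> a mod 9 = 8"
    by (rule triangle_mult_plus_square_mod_9)
  moreover have "a mod 3 = a mod 9 mod 3"
    by (simp add: mod_mod_cancel)
  ultimately show ?thesis
    by (auto simp: cong_def)
qed

end
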